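(* Suppose that for all integers $1\le t<k$ and all $g\in\mathcal G_t^\star$ one has $f(x|k,g,\phi_k)=f(x|t,g,\phi_t)$, and that for all $1\le t<k$ the ratio $f(g|k,\alpha_k)/f(g|t,\alpha_t)$ takes one and the same value $a_{kt}$ for all $g\in\mathcal G_t^\star$. Suppose also that $f(x|k,g,\phi_k)>0$ for all $k\ge1$ and $g\in\mathcal G_k$. Then for every $k\ge2$ $$f_k>a_{k,k-1}f_{k-1}.$$
   Context: Fix $n\ge1$ and data $x=(x_1,\dots,x_n)$. For each integer $k\ge1$ consider a mixture model with $k$ components. Its $j$th component ($1\le j\le k$) has density $p_{jk}(\cdot|\theta_{jk})$, the parameter $\theta_{jk}$ has prior probability density $\pi_{jk}(\cdot|\phi_{jk})$ with fixed hyperparameter $\phi_{jk}$, parameters being independent over $j$; the weights have a Dirichlet prior with hyperparameters $\alpha_{jk}>0$. Write $\phi_k=(\phi_{1k},\dots,\phi_{kk})$, $\alpha_k=(\alpha_{1k},\dots,\alpha_{kk})$, $\alpha_{0k}=\sum_{j=1}^k\alpha_{jk}$. Let $\mathcal G_k=\{1,\dots,k\}^n$ be the set of membership vectors $g=(g_1,\dots,g_n)$, so that $\mathcal G_t\subset\mathcal G_k$ for $t<k$. For $g\in\mathcal G_k$ let $A_j=\{i:g_i=j\}$, $n_j=\operatorname{card}(A_j)$, $x^j=\{x_i:i\in A_j\}$. After integrating out weights and component parameters, $$f(g|k,\alpha_k)=\frac{\Gamma(\alpha_{0k})}{\Gamma(\alpha_{0k}+n)}\prod_{j=1}^k\frac{\Gamma(\alpha_{jk}+n_j)}{\Gamma(\alpha_{jk})},\qquad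 f(x|k,g,\phi_k)=\prod_{j=1}^k q_{jk}(x^j|\phi_{jk}),$$ $$q_{jk}(x^j|\phi_{jk})=\int\prod_{i\in A_j}p_{jk}(x_i|\theta)\,\pi_{jk}(\theta|\phi_{jk})\,d\theta,$$ which are assumed finite (and $q_{jk}=1$ when $A_j=\varnothing$). The marginal likelihood is $f_k=\sum_{g\in\mathcal G_k}f(x|k,g,\phi_k)f(g|k,\alpha_k)$. Standing assumptions: for all $k\ge2$ and $1\le j\le k-1$, $\alpha_{jk}=\alpha_{jj}$, $p_{jk}(\cdot|\cdot)=p_{jj}(\cdot|\cdot)$, $\pi_{jk}(\cdot|\cdot)=\pi_{jj}(\cdot|\cdot)$, $\phi_{jk}=\phi_{jj}$. Let $\mathcal G_t^\star=\{g\in\mathcal G_t:\exists\, i\text{ with }g_i=t\}$. *)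

theory Defs
  imports "HOL-Probability.Probability"
begin

(* Doubly indexed quantities take the component index j first and the number of
   components k second, so "alpha j k" stands for alpha_jk and "\<lambda>j. alpha j k"
   for the vector alpha_k; only the entries with 1 <= j <= k are meaningful. *)

definition prob_density_wrt :: "'a measure \<Rightarrow> ('a \<Rightarrow> real) \<Rightarrow> bool" where
  "prob_density_wrt M f \<longleftrightarrow>
     f \<in> borel_measurable M \<and> (\<forall>y\<in>space M. 0 \<le> f y) \<and>
     prob_space (density M (\<lambda>y. ennreal (f y)))"

(* Extensional functions, so that there are exactly k^n membership vectors and
   memberships n t is literally a subset of memberships n k for t < k. *)
definition memberships :: "nat \<Rightarrow> nat \<Rightarrow> (nat \<Rightarrow> nat) set" where
  "memberships n k = {1..n} \<rightarrow>\<^sub>E {1..k}"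

definition memberships_star :: "nat \<Rightarrow> nat \<Rightarrow> (nat \<Rightarrow> nat) set" where
  "memberships_star n t = {g \<in> memberships n t. \<exists>i\<in>{1..n}. g i = t}"

definition cluster :: "nat \<Rightarrow> (nat \<Rightarrow> nat) \<Rightarrow> nat \<Rightarrow> nat set" where
  "cluster n g j = {i \<in> {1..n}. g i = j}"

(* f(g | k, alpha_k) *)
definition membership_prob :: "nat \<Rightarrow> nat \<Rightarrow> (nat \<Rightarrow> real) \<Rightarrow> (nat \<Rightarrow> nat) \<Rightarrow> real" where
  "membership_prob n k \<alpha> g =
     Gamma (\<Sum>j=1..k. \<alpha> j) / Gamma ((\<Sum>j=1..k. \<alpha> j) + real n) *
     (\<Prod>j=1..k. Gamma (\<alpha> j + real (card (cluster n g j))) / Gamma (\<alpha> j))"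

(* Integrand of q(x^j | phi), where A = A_j. The sub-sample x^j is the family of the
   x i with i in A, so repeated observations are counted with multiplicity. *)
definition component_integrand ::
    "('d \<Rightarrow> 'p \<Rightarrow> real) \<Rightarrow> ('p \<Rightarrow> 'h \<Rightarrow> real) \<Rightarrow> (nat \<Rightarrow> 'd) \<Rightarrow> nat set \<Rightarrow> 'h \<Rightarrow> 'p \<Rightarrow> real" where
  "component_integrand p \<pi> x A \<phi> \<theta> = (\<Prod>i\<in>A. p (x i) \<theta>) * \<pi> \<theta> \<phi>"

(* The reference measure M plays the role of d(theta). *)
definition component_marginal ::
    "'p measure \<Rightarrow> ('d \<Rightarrow> 'p \<Rightarrow> real) \<Rightarrow> ('p \<Rightarrow> 'h \<Rightarrow> real) \<Rightarrow> (nat \<Rightarrow> 'd) \<Rightarrow> nat set \<Rightarrow> 'h \<Rightarrow> real" where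
  "component_marginal M p \<pi> x A \<phi> = (\<integral>\<theta>. component_integrand p \<pi> x A \<phi> \<theta> \<partial>M)"

(* The convention q = 1 for an empty component needs no separate clause. *)
lemma component_marginal_empty:
  assumes "prob_density_wrt M (\<lambda>\<theta>. \<pi> \<theta> \<phi>)"
  shows "component_marginal M p \<pi> x {} \<phi> = 1"
proof -
  have m: "(\<lambda>\<theta>. \<pi> \<theta> \<phi>) \<in> borel_measurable M"
    and nn: "AE \<theta> in M. 0 \<le> \<pi> \<theta> \<phi>"
    and ps: "prob_space (density M (\<lambda>\<theta>. ennreal (\<pi> \<theta> \<phi>)))"
    using assms by (auto simp: prob_density_wrt_def)
  have "(\<integral>\<^sup>+\<theta>. ennreal (\<pi> \<theta> \<phi>) \<partial>M) = 1"
    using prob_space.emeasure_space_1[OF ps] m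
    by (simp add: emeasure_density cong: nn_integral_cong)
  then show ?thesis
    using m nn by (simp add: component_marginal_def component_integrand_def integral_eq_nn_integral)
qed

(* f(x | k, g, phi_k) *)
definition data_marginal ::
    "nat \<Rightarrow> nat \<Rightarrow> (nat \<Rightarrow> 'p measure) \<Rightarrow> (nat \<Rightarrow> 'd \<Rightarrow> 'p \<Rightarrow> real) \<Rightarrow> (nat \<Rightarrow> 'p \<Rightarrow> 'h \<Rightarrow> real) \<Rightarrow>
     (nat \<Rightarrow> 'd) \<Rightarrow> (nat \<Rightarrow> nat) \<Rightarrow> (nat \<Rightarrow> 'h) \<Rightarrow> real" where
  "data_marginal n k M p \<pi> x g \<phi> =
     (\<Prod>j=1..k. component_marginal (M j) (p j) (\<pi> j) x (cluster n g j) (\<phi> j))"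

(* f_k *)
definition marginal_likelihood ::
    "nat \<Rightarrow> nat \<Rightarrow> (nat \<Rightarrow> 'p measure) \<Rightarrow> (nat \<Rightarrow> 'd \<Rightarrow> 'p \<Rightarrow> real) \<Rightarrow> (nat \<Rightarrow> 'p \<Rightarrow> 'h \<Rightarrow> real) \<Rightarrow>
     (nat \<Rightarrow> 'd) \<Rightarrow> (nat \<Rightarrow> 'h) \<Rightarrow> (nat \<Rightarrow> real) \<Rightarrow> real" where
  "marginal_likelihood n k M p \<pi> x \<phi> \<alpha> =
     (\<Sum>g\<in>memberships n k. data_marginal n k M p \<pi> x g \<phi> * membership_prob n k \<alpha> g)"

end

theory Submission imports Defs begin

text \<open>
  A membership vector with labels in \<open>{1..t}\<close> leaves the components \<open>t + 1, \<dots>, k\<close> empty, and an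
  empty component contributes a factor \<open>1\<close> both to \<open>f(x | k, g, \<phi>\<^sub>k)\<close> (its prior integrates to
  \<open>1\<close>) and to the product in \<open>f(g | k, \<alpha>\<^sub>k)\<close> (its two Gamma values cancel). Since the first \<open>t\<close>
  components of both models coincide, the data marginals agree on all of \<open>\<G>\<^sub>t\<close>
  (\<open>data_marginal_extend\<close>), and the membership probabilities differ only by their Gamma
  prefactors, whose quotient does not depend on \<open>g\<close> (\<open>membership_prob_ratio\<close>). Evaluated at a
  vector in \<open>\<G>\<^sub>t\<^sup>\<star>\<close>, this quotient is \<open>a\<^sub>k\<^sub>t\<close>.

  With \<open>t = k - 1\<close>, the part of the sum \<open>f\<^sub>k\<close> over \<open>\<G>\<^sub>k\<^sub>-\<^sub>1\<close> is therefore exactly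
  \<open>a\<^sub>k\<^sub>,\<^sub>k\<^sub>-\<^sub>1 f\<^sub>k\<^sub>-\<^sub>1\<close>. The remaining terms are positive, and there is at least one of them: the
  vector that puts every observation into component \<open>k\<close>.
\<close>

lemma finite_memberships [simp]: "finite (memberships n k)"
  by (simp add: memberships_def finite_PiE)

lemma memberships_mono: "t \<le> k \<Longrightarrow> memberships n t \<subseteq> memberships n k"
  unfolding memberships_def by (rule PiE_mono) auto

lemma constant_in_memberships_star:
  assumes "1 \<le> n" and "1 \<le> t"
  shows "(\<lambda>i\<in>{1..n}. t) \<in> memberships_star n t"
  using assms by (auto simp: memberships_star_def memberships_def)

lemma memberships_star_not_smaller:
  "g \<in> memberships_star n k \<Longrightarrow> t < k \<Longrightarrow> g \<notin> memberships n t"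
  by (fastforce simp: memberships_star_def memberships_def dest: PiE_mem)

lemma cluster_empty:
  "g \<in> memberships n t \<Longrightarrow> t < j \<Longrightarrow> cluster n g j = {}"
  by (fastforce simp: cluster_def memberships_def dest: PiE_mem)

lemma membership_prob_pos:
  assumes "1 \<le> k" and "\<And>j. j \<in> {1..k} \<Longrightarrow> 0 < \<alpha> j"
  shows "0 < membership_prob n k \<alpha> g"
proof -
  have "0 < (\<Sum>j=1..k. \<alpha> j)"
    using assms by (intro sum_pos) auto
  moreover have "0 < (\<Prod>j=1..k. Gamma (\<alpha> j + real (card (cluster n g j))) / Gamma (\<alpha> j))"
    using assms(2) by (intro prod_pos) (auto intro!: divide_pos_pos Gamma_real_pos add_pos_nonneg)
  ultimately show ?thesis
    unfolding membership_prob_def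
    by (intro mult_pos_pos divide_pos_pos Gamma_real_pos add_pos_nonneg) auto
qed

text \<open>The right-hand side is free of \<open>g\<close>: only the normalising constants see the empty components
  of the larger model.\<close>

lemma membership_prob_ratio:
  assumes "1 \<le> t" and "t \<le> k" and g: "g \<in> memberships n t"
    and pos: "\<And>j. j \<in> {1..k} \<Longrightarrow> 0 < \<alpha> j"
    and eq: "\<And>j. j \<in> {1..t} \<Longrightarrow> \<beta> j = \<alpha> j"
  shows "membership_prob n k \<alpha> g / membership_prob n t \<beta> g =
    (Gamma (\<Sum>j=1..k. \<alpha> j) / Gamma ((\<Sum>j=1..k. \<alpha> j) + real n)) /
    (Gamma (\<Sum>j=1..t. \<beta> j) / Gamma ((\<Sum>j=1..t. \<beta> j) + real n))"
proof -
  let ?F = "\<lambda>\<gamma> j. Gamma (\<gamma> j + real (card (cluster n g j))) / Gamma (\<gamma> j)"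
  have "(\<Prod>j=1..k. ?F \<alpha> j) = (\<Prod>j=1..t. ?F \<alpha> j)"
  proof (rule prod.mono_neutral_right)
    show "\<forall>j\<in>{1..k} - {1..t}. ?F \<alpha> j = 1"
    proof
      fix j assume j: "j \<in> {1..k} - {1..t}"
      then have empty: "cluster n g j = {}"
        by (intro cluster_empty[OF g]) auto
      from j have "Gamma (\<alpha> j) \<noteq> 0"
        using Gamma_real_pos[of "\<alpha> j"] pos[of j] by fastforce
      then show "?F \<alpha> j = 1"
        by (simp add: empty)
    qed
  qed (use \<open>t \<le> k\<close> in auto)
  also have "\<dots> = (\<Prod>j=1..t. ?F \<beta> j)"
    by (rule prod.cong) (auto simp: eq)
  finally have *: "(\<Prod>j=1..k. ?F \<alpha> j) = (\<Prod>j=1..t. ?F \<beta> j)" .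
  have "0 < membership_prob n t \<beta> g"
    using assms by (intro membership_prob_pos) auto
  then have "(\<Prod>j=1..t. ?F \<beta> j) \<noteq> 0"
    unfolding membership_prob_def by (metis less_irrefl mult_zero_right)
  then show ?thesis
    unfolding membership_prob_def * by simp
qed

text \<open>An empty component integrates its prior density alone, so adding one changes nothing.\<close>

lemma data_marginal_extend:
  assumes "t \<le> k" and g: "g \<in> memberships n t"
    and prior: "\<And>j. j \<in> {1..k} \<Longrightarrow> prob_density_wrt (M j) (\<lambda>\<theta>. \<pi> j \<theta> (\<phi> j))"
    and eq: "\<And>j. j \<in> {1..t} \<Longrightarrow>
      M' j = M j \<and> p' j = p j \<and> \<pi>' j = \<pi> j \<and> \<phi>' j = \<phi> j"
  shows "data_marginal n k M p \<pi> x g \<phi> = data_marginal n t M' p' \<pi>' x g \<phi>'"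
proof -
  let ?q = "\<lambda>j. component_marginal (M j) (p j) (\<pi> j) x (cluster n g j) (\<phi> j)"
  have "(\<Prod>j=1..k. ?q j) = (\<Prod>j=1..t. ?q j)"
  proof (rule prod.mono_neutral_right)
    show "\<forall>j\<in>{1..k} - {1..t}. ?q j = 1"
    proof
      fix j assume j: "j \<in> {1..k} - {1..t}"
      then have empty: "cluster n g j = {}"
        by (intro cluster_empty[OF g]) auto
      from j have "prob_density_wrt (M j) (\<lambda>\<theta>. \<pi> j \<theta> (\<phi> j))"
        using prior by blast
      then show "?q j = 1"
        by (simp add: empty component_marginal_empty)
    qed
  qed (use \<open>t \<le> k\<close> in auto)
  also have "\<dots> = (\<Prod>j=1..t. component_marginal (M' j) (p' j) (\<pi>' j) x (cluster n g j) (\<phi>' j))"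
    by (rule prod.cong) (simp_all add: eq)
  finally show ?thesis
    unfolding data_marginal_def .
qed

theorem mainTheorem3:
  fixes n :: nat
    and x :: "nat \<Rightarrow> 'd"
    and N :: "'d measure"
    and M :: "nat \<Rightarrow> nat \<Rightarrow> 'p measure"
    and p :: "nat \<Rightarrow> nat \<Rightarrow> 'd \<Rightarrow> 'p \<Rightarrow> real"
    and \<pi> :: "nat \<Rightarrow> nat \<Rightarrow> 'p \<Rightarrow> 'h \<Rightarrow> real"
    and \<phi> :: "nat \<Rightarrow> nat \<Rightarrow> 'h"
    and \<alpha> :: "nat \<Rightarrow> nat \<Rightarrow> real"
    and a :: "nat \<Rightarrow> nat \<Rightarrow> real"
  defines "fx \<equiv> \<lambda>k g. data_marginal n k (\<lambda>j. M j k) (\<lambda>j. p j k) (\<lambda>j. \<pi> j k) x g (\<lambda>j. \<phi> j k)"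
    and "fg \<equiv> \<lambda>k g. membership_prob n k (\<lambda>j. \<alpha> j k) g"
    and "f \<equiv> \<lambda>k. marginal_likelihood n k (\<lambda>j. M j k) (\<lambda>j. p j k) (\<lambda>j. \<pi> j k) x
                    (\<lambda>j. \<phi> j k) (\<lambda>j. \<alpha> j k)"
  assumes "1 \<le> n"
    and "\<And>i. i \<in> {1..n} \<Longrightarrow> x i \<in> space N"
    and "\<And>j k \<theta>. 1 \<le> j \<Longrightarrow> j \<le> k \<Longrightarrow> \<theta> \<in> space (M j k) \<Longrightarrow> prob_density_wrt N (\<lambda>y. p j k y \<theta>)"
    and "\<And>j k. 1 \<le> j \<Longrightarrow> j \<le> k \<Longrightarrow> prob_density_wrt (M j k) (\<lambda>\<theta>. \<pi> j k \<theta> (\<phi> j k))"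
    and "\<And>j k. 1 \<le> j \<Longrightarrow> j \<le> k \<Longrightarrow> 0 < \<alpha> j k"
    and "\<And>j k g. 1 \<le> j \<Longrightarrow> j \<le> k \<Longrightarrow> g \<in> memberships n k \<Longrightarrow>
           integrable (M j k) (component_integrand (p j k) (\<pi> j k) x (cluster n g j) (\<phi> j k))"
    and "\<And>j k. 2 \<le> k \<Longrightarrow> 1 \<le> j \<Longrightarrow> j \<le> k - 1 \<Longrightarrow>
           \<alpha> j k = \<alpha> j j \<and> M j k = M j j \<and> p j k = p j j \<and> \<pi> j k = \<pi> j j \<and> \<phi> j k = \<phi> j j"
    and "\<And>t k g. 1 \<le> t \<Longrightarrow> t < k \<Longrightarrow> g \<in> memberships_star n t \<Longrightarrow> fx k g = fx t g"
    and "\<And>t k g. 1 \<le> t \<Longrightarrow> t < k \<Longrightarrow> g \<in> memberships_star n t \<Longrightarrow> fg k g / fg t g = a k t"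
    and "\<And>k g. 1 \<le> k \<Longrightarrow> g \<in> memberships n k \<Longrightarrow> 0 < fx k g"
  shows "\<forall>k\<ge>2. f k > a k (k - 1) * f (k - 1)"
proof (intro allI impI)
  note prior = assms(7) and \<alpha>_pos = assms(8) and nested = assms(10)
    and ratio = assms(12) and fx_pos = assms(13)
  fix k :: nat assume k: "2 \<le> k"
  define t where "t = k - 1"
  have t: "1 \<le> t" "t < k" "t \<le> k" using k by (auto simp: t_def)
  have coincide: "\<alpha> j t = \<alpha> j k \<and> M j t = M j k \<and> p j t = p j k \<and> \<pi> j t = \<pi> j k \<and> \<phi> j t = \<phi> j k"
    if j: "j \<in> {1..t}" for j
  proof (cases "j = t")
    case True
    then show ?thesis using nested[of k j] k j by (simp add: t_def)
  next
    case False
    then have "2 \<le> t" "j \<le> t - 1" using j by auto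
    then show ?thesis using nested[of k j] nested[of t j] k j by (simp add: t_def)
  qed
  have fg_pos: "0 < fg s g" if "1 \<le> s" for s g
    unfolding fg_def using that \<alpha>_pos by (intro membership_prob_pos) auto
  have fx_eq: "fx k g = fx t g" if "g \<in> memberships n t" for g
    unfolding fx_def using that t prior coincide by (intro data_marginal_extend) auto
  have fg_eq: "fg k g = a k t * fg t g" if g: "g \<in> memberships n t" for g
  proof -
    define c where "c = (\<lambda>i\<in>{1..n}. t)"
    have c: "c \<in> memberships_star n t"
      unfolding c_def using \<open>1 \<le> n\<close> t by (rule_tac constant_in_memberships_star)
    then have "c \<in> memberships n t" by (simp add: memberships_star_def)
    have quot: "fg k h / fg t h =
        (Gamma (\<Sum>j=1..k. \<alpha> j k) / Gamma ((\<Sum>j=1..k. \<alpha> j k) + real n)) /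
        (Gamma (\<Sum>j=1..t. \<alpha> j t) / Gamma ((\<Sum>j=1..t. \<alpha> j t) + real n))"
      if "h \<in> memberships n t" for h
      unfolding fg_def using that t \<alpha>_pos coincide by (intro membership_prob_ratio) auto
    have "fg k g / fg t g = fg k c / fg t c"
      by (simp only: quot[OF g] quot[OF \<open>c \<in> memberships n t\<close>])
    also have "\<dots> = a k t"
      using ratio t c by blast
    finally show ?thesis
      using fg_pos[of t g] t by (simp add: field_simps)
  qed
  have f_eq: "f s = (\<Sum>g\<in>memberships n s. fx s g * fg s g)" for s
    unfolding f_def fx_def fg_def marginal_likelihood_def ..
  have "a k t * f t = (\<Sum>g\<in>memberships n t. fx k g * fg k g)"
    by (simp add: f_eq sum_distrib_left fx_eq fg_eq mult_ac)
  also have "\<dots> < (\<Sum>g\<in>memberships n k. fx k g * fg k g)"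
  proof (rule sum_strict_mono2)
    let ?c = "\<lambda>i\<in>{1..n}. k"
    have c: "?c \<in> memberships_star n k"
      using \<open>1 \<le> n\<close> k by (intro constant_in_memberships_star) auto
    then show "?c \<in> memberships n k - memberships n t"
      using memberships_star_not_smaller[OF c \<open>t < k\<close>] by (simp add: memberships_star_def)
    then show "0 < fx k ?c * fg k ?c"
      using fx_pos fg_pos k by simp
    show "0 \<le> fx k g * fg k g" if "g \<in> memberships n k" for g
      using fx_pos[of k g] fg_pos[of k g] that k by simp
  qed (use memberships_mono[OF \<open>t \<le> k\<close>] in auto)
  also have "\<dots> = f k"
    by (simp add: f_eq)
  finally show "f k > a k (k - 1) * f (k - 1)"
    by (simp add: t_def)
qed

end
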